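(* Let $R$ be a root system of one of the types $A_n$, $B_n$, $C_n$, $D_n$, realized in orthogonal coordinates $x_1,\dots,x_r$, where $r=n+1$ for $A_n$ and $r=n$ for $B_n,C_n,D_n$ (for $A_n$ everything lies in the hyperplane $x_1+\cdots+x_{n+1}=0$). Let $F$ be the fundamental domain of the affine Weyl group $W^{\rm aff}(R)$, and let $$\Delta=\frac{\partial^2}{\partial x_1^2}+\frac{\partial^2}{\partial x_2^2}+\cdots+\frac{\partial^2}{\partial x_r^2}.$$ Let $\lambda=(m_1,\dots,m_r)\in P_+$, written in orthogonal coordinates, and let $\phi_\lambda(x)=\sum_{\mu\in O(\lambda)}e^{2\pi \mathrm{i}\langle\mu,x\rangle}$ be the corresponding orbit function. Then $$\Delta\phi_\lambda(x)=-4\pi^2\langle\lambda,\lambda\rangle\,\phi_\lambda(x),\qquad \langle\lambda,\lambda\rangle=m_1^2+\cdots+m_r^2 .$$ Thus the orbit functions $\phi_\lambda$, $\lambda\in P_+$, are eigenfunctions of the Laplace operator on $F$, and they satisfy the Neumann boundary condition $$\left.\frac{\partial\phi_\lambda(x)}{\partial m}\right|_{\partial F}=0,\qquad \lambda\in P_+,$$ where $\partial F$ is the $(n-1)$-dimensional boundary of $F$ and $m$ is the normal to the boundary.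
   Context: $\boldsymbol e_1,\dots,\boldsymbol e_r$ are the orthonormal unit vectors along the coordinates and $\langle\cdot,\cdot\rangle$ is the standard scalar product. The simple roots are: $\alpha_i=\boldsymbol e_i-\boldsymbol e_{i+1}$ ($1\le i\le n$) for $A_n$; $\alpha_i=\boldsymbol e_i-\boldsymbol e_{i+1}$ ($1\le i\le n-1$) together with $\alpha_n=\boldsymbol e_n$ for $B_n$, $\alpha_n=2\boldsymbol e_n$ for $C_n$, $\alpha_n=\boldsymbol e_{n-1}+\boldsymbol e_n$ for $D_n$. For a root $\alpha$, $\alpha^\vee=2\alpha/\langle\alpha,\alpha\rangle$ and $r_\alpha x=x-\langle x,\alpha^\vee\rangle\alpha$. The Weyl group $W$ is generated by $r_{\alpha_1},\dots,r_{\alpha_n}$. $P_+$ is the set of dominant integral weights, i.e. the $\lambda$ in the span of the roots with $\langle\lambda,\alpha_j^\vee\rangle\in\{0,1,2,\dots\}$ for all $j$. $O(\lambda)$ is the set of distinct points $w\lambda$, $w\in W$. With $\xi$ the highest root, $W^{\rm aff}$ is generated by $r_{\alpha_1},\dots,r_{\alpha_n}$ and $r_0x=r_\xi x+\xi^\vee$, and its fundamental domain $F$ is the open simplex of points $y$ in the span of the roots with $\langle y,\alpha_i\rangle>0$ ($i=1,\dots,n$) and $\langle y,\xi\rangle<1$. *)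

theory Defs
  imports "HOL-Analysis.Analysis" "HOL-Algebra.Bij" "HOL-Algebra.Generated_Groups"
begin

datatype classical_type = Type_A nat | Type_B nat | Type_C nat | Type_D nat

fun root_rank :: "classical_type \<Rightarrow> nat" where
  "root_rank (Type_A n) = n"
| "root_rank (Type_B n) = n"
| "root_rank (Type_C n) = n"
| "root_rank (Type_D n) = n"

fun coord_dim :: "classical_type \<Rightarrow> nat" where
  "coord_dim (Type_A n) = n + 1"
| "coord_dim (Type_B n) = n"
| "coord_dim (Type_C n) = n"
| "coord_dim (Type_D n) = n"

(* The ranks for which the simple roots below make sense and the root system is irreducible
   (D_2 has no highest root).  The small ranks B_1, C_1, D_3 that coincide with other types are
   allowed, so every common convention on the admissible ranks is covered. *)
fun valid_type :: "classical_type \<Rightarrow> bool" where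
  "valid_type (Type_A n) \<longleftrightarrow> n \<ge> 1"
| "valid_type (Type_B n) \<longleftrightarrow> n \<ge> 1"
| "valid_type (Type_C n) \<longleftrightarrow> n \<ge> 1"
| "valid_type (Type_D n) \<longleftrightarrow> n \<ge> 3"

(* Throughout, e enumerates the standard basis: e 1, ..., e r are the unit vectors along the
   coordinates.  Only the indices 1 \<le> i \<le> root_rank R are meaningful. *)
fun simple_root :: "(nat \<Rightarrow> 'a::euclidean_space) \<Rightarrow> classical_type \<Rightarrow> nat \<Rightarrow> 'a" where
  "simple_root e (Type_A n) i = e i - e (i + 1)"
| "simple_root e (Type_B n) i = (if i = n then e n else e i - e (i + 1))"
| "simple_root e (Type_C n) i = (if i = n then 2 *\<^sub>R e n else e i - e (i + 1))"
| "simple_root e (Type_D n) i = (if i = n then e (n - 1) + e n else e i - e (i + 1))"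

definition coroot :: "'a::euclidean_space \<Rightarrow> 'a" where
  "coroot \<alpha> = (2 / (\<alpha> \<bullet> \<alpha>)) *\<^sub>R \<alpha>"

definition root_reflection :: "'a::euclidean_space \<Rightarrow> 'a \<Rightarrow> 'a" where
  "root_reflection \<alpha> x = x - (x \<bullet> coroot \<alpha>) *\<^sub>R \<alpha>"

definition weyl_group :: "(nat \<Rightarrow> 'a::euclidean_space) \<Rightarrow> classical_type \<Rightarrow> ('a \<Rightarrow> 'a) set" where
  "weyl_group e R =
     generate (BijGroup UNIV) ((\<lambda>i. root_reflection (simple_root e R i)) ` {1..root_rank R})"

definition roots :: "(nat \<Rightarrow> 'a::euclidean_space) \<Rightarrow> classical_type \<Rightarrow> 'a set" where
  "roots e R = {w (simple_root e R i) | w i. w \<in> weyl_group e R \<and> i \<in> {1..root_rank R}}"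

definition is_highest_root ::
    "(nat \<Rightarrow> 'a::euclidean_space) \<Rightarrow> classical_type \<Rightarrow> 'a \<Rightarrow> bool" where
  "is_highest_root e R \<xi> \<longleftrightarrow> \<xi> \<in> roots e R \<and>
     (\<forall>\<alpha>\<in>roots e R. \<exists>c :: nat \<Rightarrow> nat.
        \<xi> - \<alpha> = (\<Sum>i=1..root_rank R. real (c i) *\<^sub>R simple_root e R i))"

definition dominant_weights :: "(nat \<Rightarrow> 'a::euclidean_space) \<Rightarrow> classical_type \<Rightarrow> 'a set" where
  "dominant_weights e R =
     {l \<in> span (roots e R). \<forall>j\<in>{1..root_rank R}. l \<bullet> coroot (simple_root e R j) \<in> \<nat>}"

definition weyl_orbit ::
    "(nat \<Rightarrow> 'a::euclidean_space) \<Rightarrow> classical_type \<Rightarrow> 'a \<Rightarrow> 'a set" where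
  "weyl_orbit e R l = (\<lambda>w. w l) ` weyl_group e R"

(* Since the Weyl group is finite, the sum ranges over a finite set. *)
definition orbit_function ::
    "(nat \<Rightarrow> 'a::euclidean_space) \<Rightarrow> classical_type \<Rightarrow> 'a \<Rightarrow> 'a \<Rightarrow> complex" where
  "orbit_function e R l x =
     (\<Sum>\<mu>\<in>weyl_orbit e R l. exp (2 * complex_of_real pi * \<i> * complex_of_real (\<mu> \<bullet> x)))"

(* \<xi> is meant to be the highest root; the set is then the open simplex that is the fundamental
   domain of the affine Weyl group. *)
definition fund_domain ::
    "(nat \<Rightarrow> 'a::euclidean_space) \<Rightarrow> classical_type \<Rightarrow> 'a \<Rightarrow> 'a set" where
  "fund_domain e R \<xi> =
     {y \<in> span (roots e R). (\<forall>i\<in>{1..root_rank R}. y \<bullet> simple_root e R i > 0) \<and> y \<bullet> \<xi> < 1}"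

definition partial_deriv ::
    "'a::euclidean_space \<Rightarrow> ('a \<Rightarrow> complex) \<Rightarrow> 'a \<Rightarrow> complex" where
  "partial_deriv b f x = vector_derivative (\<lambda>t. f (x + t *\<^sub>R b)) (at 0)"

definition laplacian ::
    "(nat \<Rightarrow> 'a::euclidean_space) \<Rightarrow> nat \<Rightarrow> ('a \<Rightarrow> complex) \<Rightarrow> 'a \<Rightarrow> complex" where
  "laplacian e r f x = (\<Sum>i=1..r. partial_deriv (e i) (partial_deriv (e i) f) x)"

definition eigenfunction_on ::
    "(('a \<Rightarrow> complex) \<Rightarrow> 'a \<Rightarrow> complex) \<Rightarrow> 'a set \<Rightarrow> ('a \<Rightarrow> complex) \<Rightarrow> complex \<Rightarrow> bool" where
  "eigenfunction_on L S f c \<longleftrightarrow> (\<exists>x\<in>S. f x \<noteq> 0) \<and> (\<forall>x\<in>S. L f x = c * f x)"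

(* m is normal at x to the boundary of the convex set S inside the subspace V: it is a direction in V
   orthogonal to a codimension-one face through x.  Where several such faces meet, the normals of
   all of them are admitted.  No normalization of the length of m is imposed. *)
definition boundary_normal ::
    "'a::euclidean_space set \<Rightarrow> 'a set \<Rightarrow> 'a \<Rightarrow> 'a \<Rightarrow> bool" where
  "boundary_normal V S x m \<longleftrightarrow> m \<in> V \<and> m \<noteq> 0 \<and>
     (\<exists>T. T facet_of closure S \<and> x \<in> T \<and> (\<forall>y\<in>T. \<forall>z\<in>T. m \<bullet> (y - z) = 0))"

end

theory Submission
  imports Defs
begin

text \<open>Each exponential of an orbit function is an eigenfunction of the Laplacian, and the Weyl group
  is orthogonal, so all of them share one eigenvalue. A facet of the fundamental simplex lies in a
  hyperplane \<open>\<alpha> \<bullet> x = b\<close> with \<open>\<alpha>\<close> a root and \<open>b \<in> {0, 1}\<close>, so its normals are multiples of \<open>\<alpha>\<close>.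
  Reflecting the orbit in \<open>\<alpha>\<close> changes the sign of the derivative along \<open>\<alpha>\<close> at points of this
  hyperplane, because \<open>\<mu> \<bullet> \<alpha>\<^sup>\<or>\<close> is an integer for every orbit point \<open>\<mu>\<close>.\<close>

section \<open>Exponential sums\<close>

text \<open>An abbreviation rather than a definition, so that unfolding
  \<open>orbit_function_def\<close> yields sums of plane waves literally.\<close>

abbreviation plane_wave :: "'a::euclidean_space \<Rightarrow> 'a \<Rightarrow> complex" where
  "plane_wave \<mu> x \<equiv> exp (2 * complex_of_real pi * \<i> * complex_of_real (\<mu> \<bullet> x))"

text \<open>The coefficients \<open>c\<close> are carried along because the derivative is then a sum
  of the same form, which can be differentiated again.\<close>

lemma exp_sum_has_vector_derivative:
  fixes c :: "'a::euclidean_space \<Rightarrow> complex"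
  shows "((\<lambda>t. \<Sum>\<mu>\<in>M. c \<mu> * plane_wave \<mu> (x + t *\<^sub>R b)) has_vector_derivative
          (\<Sum>\<mu>\<in>M. c \<mu> * (2 * complex_of_real pi * \<i> * complex_of_real (\<mu> \<bullet> b)) * plane_wave \<mu> x)) (at 0)"
proof -
  have "((\<lambda>t. plane_wave \<mu> (x + t *\<^sub>R b)) has_vector_derivative
          (2 * complex_of_real pi * \<i> * complex_of_real (\<mu> \<bullet> b)) * plane_wave \<mu> x) (at 0)" for \<mu>
  proof -
    \<comment> \<open>The real parameter is first replaced by a complex variable, where the field
      derivative applies, and then restricted to the real line.\<close>
    have "((\<lambda>z. exp (2 * complex_of_real pi * \<i> * (complex_of_real (\<mu> \<bullet> x) + z * complex_of_real (\<mu> \<bullet> b))))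
            has_field_derivative
          (2 * complex_of_real pi * \<i> * complex_of_real (\<mu> \<bullet> b)) * plane_wave \<mu> x) (at (complex_of_real 0))"
      by (auto intro!: derivative_eq_intros)
    from has_vector_derivative_real_field[OF this] show ?thesis
      by (simp add: inner_add_right o_def)
  qed
  then show ?thesis
    by (auto intro!: derivative_eq_intros simp: mult.assoc)
qed

text \<open>Stated as an equality of functions so that it also rewrites the inner derivative of a
  nested \<open>partial_deriv\<close>.\<close>

lemma partial_deriv_exp_sum:
  fixes c :: "'a::euclidean_space \<Rightarrow> complex"
  shows "partial_deriv b (\<lambda>x. \<Sum>\<mu>\<in>M. c \<mu> * plane_wave \<mu> x) =
    (\<lambda>x. \<Sum>\<mu>\<in>M. c \<mu> * (2 * complex_of_real pi * \<i> * complex_of_real (\<mu> \<bullet> b)) * plane_wave \<mu> x)"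
  unfolding partial_deriv_def
  by (rule ext, rule vector_derivative_at, rule exp_sum_has_vector_derivative)

lemma inner_self_eq_sum_coordinates:
  fixes e :: "nat \<Rightarrow> 'a::euclidean_space"
  assumes "bij_betw e {1..r} (Basis :: 'a set)"
  shows "v \<bullet> v = (\<Sum>i=1..r. (v \<bullet> e i)\<^sup>2)"
proof -
  have "v \<bullet> v = (\<Sum>b\<in>Basis. (v \<bullet> b)\<^sup>2)"
    by (subst euclidean_inner) (simp add: power2_eq_square)
  also have "\<dots> = (\<Sum>i=1..r. (v \<bullet> e i)\<^sup>2)"
    by (rule sum.reindex_bij_betw[OF assms, symmetric])
  finally show ?thesis .
qed

text \<open>Differentiating twice along \<open>e i\<close> multiplies the wave of \<mu> by (2 pi i
  \<mu>_i)^2, and these factors add up to -4 pi^2 times the squared norm of \<mu>. On a sphere this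
  is one constant for the whole sum.\<close>

lemma laplacian_plane_wave_sum:
  fixes e :: "nat \<Rightarrow> 'a::euclidean_space"
  assumes e: "bij_betw e {1..r} (Basis :: 'a set)"
    and sphere: "\<And>\<mu>. \<mu> \<in> M \<Longrightarrow> \<mu> \<bullet> \<mu> = q"
  shows "laplacian e r (\<lambda>x. \<Sum>\<mu>\<in>M. plane_wave \<mu> x) x =
         complex_of_real (- 4 * pi\<^sup>2 * q) * (\<Sum>\<mu>\<in>M. plane_wave \<mu> x)"
proof -
  let ?d = "\<lambda>i \<mu>. 2 * complex_of_real pi * \<i> * complex_of_real (\<mu> \<bullet> e i)"
  have "laplacian e r (\<lambda>x. \<Sum>\<mu>\<in>M. plane_wave \<mu> x) x =
        (\<Sum>i=1..r. \<Sum>\<mu>\<in>M. ?d i \<mu> * ?d i \<mu> * plane_wave \<mu> x)"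
    unfolding laplacian_def
    using partial_deriv_exp_sum[where c = "\<lambda>_. 1" and M = M]
    by (simp only: mult_1 partial_deriv_exp_sum)
  also have "\<dots> = (\<Sum>\<mu>\<in>M. (\<Sum>i=1..r. ?d i \<mu> * ?d i \<mu>) * plane_wave \<mu> x)"
    by (subst sum.swap) (simp add: sum_distrib_right)
  also have "\<dots> = (\<Sum>\<mu>\<in>M. complex_of_real (- 4 * pi\<^sup>2 * q) * plane_wave \<mu> x)"
  proof (rule sum.cong[OF refl])
    fix \<mu> assume "\<mu> \<in> M"
    have "(\<Sum>i=1..r. ?d i \<mu> * ?d i \<mu>) = (\<Sum>i=1..r. complex_of_real (- 4 * pi\<^sup>2 * (\<mu> \<bullet> e i)\<^sup>2))"
      by (rule sum.cong) (auto simp: power2_eq_square algebra_simps)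
    also have "\<dots> = complex_of_real (- 4 * pi\<^sup>2 * (\<Sum>i=1..r. (\<mu> \<bullet> e i)\<^sup>2))"
      by (simp only: of_real_sum[symmetric] sum_distrib_left)
    also have "\<dots> = complex_of_real (- 4 * pi\<^sup>2 * q)"
      using sphere[OF \<open>\<mu> \<in> M\<close>] inner_self_eq_sum_coordinates[OF e, of \<mu>] by simp
    finally show "(\<Sum>i=1..r. ?d i \<mu> * ?d i \<mu>) * plane_wave \<mu> x =
        complex_of_real (- 4 * pi\<^sup>2 * q) * plane_wave \<mu> x"
      by simp
  qed
  finally show ?thesis
    by (simp add: sum_distrib_left)
qed

section \<open>Facets of polyhedra\<close>

text \<open>A relative interior point \<open>p\<close> of the facet lies outside \<open>F\<close>,
  so one strict inequality fails at \<open>p\<close> and, on the closure, becomes an equality there.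
  The supporting hyperplane it defines cuts \<open>T\<close> in a face meeting the relative interior
  of \<open>T\<close>, hence in all of \<open>T\<close>.\<close>

lemma facet_in_tight_hyperplane:
  fixes V :: "'a::euclidean_space set" and C :: "('a \<times> real) set"
  assumes V: "subspace V" and C: "finite C"
    and F: "F = V \<inter> {y. \<forall>(a, b)\<in>C. a \<bullet> y < b}" "F \<noteq> {}"
    and T: "T facet_of closure F"
  shows "T \<subseteq> V" "aff_dim T = int (dim V) - 1"
    "\<exists>(a, b)\<in>C. \<forall>y\<in>T. a \<bullet> y = b"
proof -
  let ?O = "\<Inter>(a, b)\<in>C. {y. a \<bullet> y < b}"
  have F': "F = V \<inter> ?O"
    using F by auto
  have "open ?O"
    using C by (intro open_INT) (auto simp: open_halfspace_lt)
  then have op: "openin (top_of_set V) F"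
    unfolding F' by auto
  have conv: "convex F"
    unfolding F' using subspace_imp_convex[OF V]
    by (intro convex_Int convex_INT) (auto simp: convex_halfspace_lt)
  have affV: "affine hull V = V"
    using V by (simp add: subspace_imp_affine)
  \<comment> \<open>A nonempty relatively open subset of \<open>V\<close> has affine hull
    \<open>V\<close>, so \<open>F\<close> is its own relative interior and, being convex, also that
    of its closure.\<close>
  have affF: "affine hull F = V"
    using affine_hull_openin[of V F] op F(2) affV by simp
  have relF: "rel_interior F = F"
    using rel_interior_openin[of F] op affF by simp
  have relcl: "rel_interior (closure F) = F"
    using convex_rel_interior_closure[OF conv] relF by simp
  have face: "T face_of closure F" and "T \<noteq> {}" and dimT: "aff_dim T = aff_dim (closure F) - 1"
    using T by (auto simp: facet_of_def)
  have clV: "closure F \<subseteq> V"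
    using V F' by (intro closure_minimal) (auto simp: closed_subspace)
  have "T \<subseteq> closure F"
    using face face_of_imp_subset by blast
  with clV show "T \<subseteq> V"
    by blast
  have "aff_dim (closure F) = aff_dim F"
    by simp
  also have "\<dots> = int (dim V)"
    using affF aff_dim_affine_hull[of F] aff_dim_subspace[OF V] by simp
  finally show "aff_dim T = int (dim V) - 1"
    using dimT by simp
  have weak: "a \<bullet> y \<le> b" if "(a, b) \<in> C" "y \<in> closure F" for a b y
  proof -
    have "closure F \<subseteq> {y. a \<bullet> y \<le> b}"
      using that(1) F by (intro closure_minimal) (auto simp: closed_halfspace_le intro: less_imp_le)
    then show ?thesis
      using that(2) by blast
  qed
  have convT: "convex T"
    using face by (rule face_of_imp_convex)
  then obtain p where p: "p \<in> rel_interior T"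
    using \<open>T \<noteq> {}\<close> rel_interior_eq_empty by blast
  then have pT: "p \<in> T"
    using rel_interior_subset by blast
  \<comment> \<open>The drop in dimension makes \<open>T\<close> a proper face, and a proper face
    misses the relative interior of the closure, which is \<open>F\<close>.\<close>
  have "T \<noteq> closure F"
    using dimT by auto
  then have "p \<notin> F"
    using face_of_disjoint_rel_interior[OF face] relcl pT by blast
  then obtain a b where ab: "(a, b) \<in> C" "\<not> a \<bullet> p < b"
    using F(1) pT \<open>T \<subseteq> V\<close> by blast
  then have eq: "a \<bullet> p = b"
    using weak[OF ab(1), of p] pT \<open>T \<subseteq> closure F\<close> by force
  have "T \<inter> {y. a \<bullet> y = b} face_of T"
    using weak[OF ab(1)] \<open>T \<subseteq> closure F\<close> by (intro face_of_Int_supporting_hyperplane_le convT) blast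
  then have "T \<inter> {y. a \<bullet> y = b} = T"
    using face_of_disjoint_rel_interior[of "T \<inter> {y. a \<bullet> y = b}" T] p pT eq by blast
  then show "\<exists>(a, b)\<in>C. \<forall>y\<in>T. a \<bullet> y = b"
    using ab(1) by blast
qed

text \<open>The differences of points of \<open>T\<close> span a subspace of codimension one in
  \<open>V\<close>. Its orthogonal complement within \<open>V\<close> is a line, which contains both
  \<open>m\<close> and the nonzero vector \<open>a\<close>.\<close>

lemma hyperplane_normals_parallel:
  fixes V :: "'a::euclidean_space set"
  assumes V: "subspace V" and T: "T \<subseteq> V" "p \<in> T" "aff_dim T = int (dim V) - 1"
    and a: "a \<in> V" "a \<noteq> 0" "\<And>y z. y \<in> T \<Longrightarrow> z \<in> T \<Longrightarrow> a \<bullet> (y - z) = 0"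
    and m: "m \<in> V" "\<And>y z. y \<in> T \<Longrightarrow> z \<in> T \<Longrightarrow> m \<bullet> (y - z) = 0"
  shows "\<exists>k. m = k *\<^sub>R a"
proof -
  let ?D = "(\<lambda>y. y - p) ` T"
  have Dim: "aff_dim T = int (dim ?D)"
    using T(2) by (intro aff_dim_eq_dim_subtract) (simp add: hull_inc)
  let ?U = "span ?D"
  let ?N = "{y \<in> V. \<forall>x \<in> ?U. orthogonal x y}"
  have "?U \<subseteq> V"
    using T V by (intro span_minimal) (auto intro: subspace_diff)
  then have "dim ?N + dim ?U = dim V"
    using V by (intro dim_subspace_orthogonal_to_vectors) auto
  then have dimN: "dim ?N = 1"
    using Dim T(3) by simp
  have inN: "v \<in> ?N" if v: "v \<in> V" "\<And>y z. y \<in> T \<Longrightarrow> z \<in> T \<Longrightarrow> v \<bullet> (y - z) = 0" for v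
  proof -
    have "orthogonal v x" if "x \<in> ?U" for x
      using that by (rule orthogonal_to_span) (use v(2) T(2) in \<open>auto simp: orthogonal_def\<close>)
    then show ?thesis
      using v(1) by (auto simp: orthogonal_commute)
  qed
  \<comment> \<open>The independent set \<open>{a}\<close> has as many elements as the dimension of
    \<open>?N\<close>, so it spans \<open>?N\<close>.\<close>
  have "?N \<subseteq> span {a}"
    using inN[OF a(1,3)] a(2) dimN by (intro card_ge_dim_independent) auto
  then show ?thesis
    using inN[OF m] by (auto simp: span_singleton)
qed

section \<open>Reflections\<close>

lemma inner_coroot: "x \<bullet> coroot \<alpha> = 2 * (x \<bullet> \<alpha>) / (\<alpha> \<bullet> \<alpha>)"
  by (simp add: coroot_def)

lemma linear_root_reflection: "linear (root_reflection \<alpha>)"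
  unfolding root_reflection_def by (rule linearI) (auto simp: algebra_simps)

lemma inner_root_reflection: "root_reflection \<alpha> x \<bullet> y = x \<bullet> y - (x \<bullet> coroot \<alpha>) * (\<alpha> \<bullet> y)"
  by (simp add: root_reflection_def inner_diff_left)

lemma inner_root_reflection_root: "root_reflection \<alpha> x \<bullet> \<alpha> = - (x \<bullet> \<alpha>)"
  by (cases "\<alpha> = 0") (auto simp: inner_root_reflection inner_coroot)

lemma root_reflection_involution [simp]: "root_reflection \<alpha> (root_reflection \<alpha> x) = x"
proof -
  have "root_reflection \<alpha> x \<bullet> coroot \<alpha> = - (x \<bullet> coroot \<alpha>)"
    by (simp add: inner_coroot inner_root_reflection_root)
  then show ?thesis
    by (simp add: root_reflection_def[of \<alpha> "root_reflection \<alpha> x"]) (simp add: root_reflection_def)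
qed

lemma orthogonal_transformation_root_reflection: "orthogonal_transformation (root_reflection \<alpha>)"
proof -
  have "root_reflection \<alpha> x \<bullet> root_reflection \<alpha> y = x \<bullet> y" for x y
  proof -
    have "root_reflection \<alpha> x \<bullet> root_reflection \<alpha> y
        = root_reflection \<alpha> x \<bullet> y - (y \<bullet> coroot \<alpha>) * (root_reflection \<alpha> x \<bullet> \<alpha>)"
      using inner_root_reflection[of \<alpha> y "root_reflection \<alpha> x"] by (simp add: inner_commute)
    also have "\<dots> = x \<bullet> y"
      unfolding inner_root_reflection_root inner_root_reflection[of \<alpha> x y] inner_coroot
      by (simp add: inner_commute)
    finally show ?thesis .
  qed
  then show ?thesis
    by (simp add: orthogonal_transformation_def linear_root_reflection)
qed

text \<open>An isometry preserves the coefficient of the root in the reflection formula. This is the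
  conjugation rule for reflections, written without an inverse.\<close>

lemma root_reflection_conjugate:
  assumes w: "orthogonal_transformation w"
  shows "root_reflection (w \<alpha>) (w x) = w (root_reflection \<alpha> x)"
proof -
  have lin: "linear w" and inn: "w u \<bullet> w v = u \<bullet> v" for u v
    using w by (auto simp: orthogonal_transformation_def)
  then show ?thesis
    by (simp add: root_reflection_def inner_coroot linear_diff linear_cmul)
qed

section \<open>The Weyl group\<close>

lemma root_reflection_in_Bij: "root_reflection \<alpha> \<in> carrier (BijGroup UNIV)"
  by (auto simp: BijGroup_def Bij_def intro!: bij_betw_byWitness[where f' = "root_reflection \<alpha>"])

lemma weyl_group_subgroup: "subgroup (weyl_group e R) (BijGroup UNIV)"
  unfolding weyl_group_def
  by (rule group.generate_is_subgroup[OF group_BijGroup]) (use root_reflection_in_Bij in blast)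

lemma weyl_group_bij: "w \<in> weyl_group e R \<Longrightarrow> bij w"
  using subgroup.mem_carrier[OF weyl_group_subgroup] by (auto simp: BijGroup_def Bij_def)

text \<open>The product of \<open>BijGroup\<close> is the restricted composition
  \<open>compose\<close>, which on \<open>UNIV\<close> is ordinary composition.\<close>

lemma weyl_group_mult:
  "v \<in> Bij UNIV \<Longrightarrow> w \<in> Bij UNIV \<Longrightarrow> v \<otimes>\<^bsub>BijGroup UNIV\<^esub> w = v \<circ> w"
  by (auto simp: BijGroup_def compose_def)

lemma weyl_group_Bij: "w \<in> weyl_group e R \<Longrightarrow> w \<in> Bij UNIV"
  using weyl_group_bij by (auto simp: Bij_def)

lemma weyl_group_id: "(\<lambda>x. x) \<in> weyl_group e R"
  using subgroup.one_closed[OF weyl_group_subgroup, of e R] by (simp add: BijGroup_def restrict_def)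

lemma weyl_group_comp:
  "v \<in> weyl_group e R \<Longrightarrow> w \<in> weyl_group e R \<Longrightarrow> v \<circ> w \<in> weyl_group e R"
  using subgroup.m_closed[OF weyl_group_subgroup] weyl_group_mult weyl_group_Bij by metis

lemma weyl_group_inv: "w \<in> weyl_group e R \<Longrightarrow> inv_into UNIV w \<in> weyl_group e R"
  using subgroup.m_inv_closed[OF weyl_group_subgroup, of w e R] inv_BijGroup[OF weyl_group_Bij, of w e R]
  by (simp add: restrict_def)

lemma weyl_group_generator:
  "i \<in> {1..root_rank R} \<Longrightarrow> root_reflection (simple_root e R i) \<in> weyl_group e R"
  unfolding weyl_group_def by (intro generate.incl) blast

text \<open>The generators are involutions, so the inverse case of \<open>generate\<close> falls
  back on the case of a generator.\<close>

lemma weyl_group_induct [consumes 1, case_names id reflection comp]: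
  assumes w: "w \<in> weyl_group e R"
    and id: "P (\<lambda>x. x)"
    and refl: "\<And>i. i \<in> {1..root_rank R} \<Longrightarrow> P (root_reflection (simple_root e R i))"
    and comp: "\<And>v w. P v \<Longrightarrow> P w \<Longrightarrow> P (v \<circ> w)"
  shows "P w"
proof -
  let ?H = "(\<lambda>i. root_reflection (simple_root e R i)) ` {1..root_rank R}"
  have inv_refl: "inv\<^bsub>BijGroup UNIV\<^esub> root_reflection \<alpha> = root_reflection \<alpha>" for \<alpha> :: 'a
    using root_reflection_in_Bij[of \<alpha>]
    by (intro group.inv_equality[OF group_BijGroup])
      (auto simp: BijGroup_def compose_def)
  have "w \<in> generate (BijGroup UNIV) ?H"
    using w by (simp add: weyl_group_def)
  then show ?thesis
  proof induction
    case one
    then show ?case using id by (simp add: BijGroup_def restrict_def)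
  next
    case (incl h)
    then show ?case using refl by blast
  next
    case (inv h)
    then show ?case using refl inv_refl by auto
  next
    case (eng h1 h2)
    then have "h1 \<in> Bij UNIV" "h2 \<in> Bij UNIV"
      using weyl_group_Bij unfolding weyl_group_def by blast+
    then show ?case
      using eng comp weyl_group_mult by metis
  qed
qed

lemma weyl_group_orthogonal: "w \<in> weyl_group e R \<Longrightarrow> orthogonal_transformation w"
  by (induction rule: weyl_group_induct)
    (simp_all add: orthogonal_transformation_root_reflection orthogonal_transformation_compose
      del: o_apply)

lemma weyl_group_inner: "w \<in> weyl_group e R \<Longrightarrow> w u \<bullet> w v = u \<bullet> v"
  using weyl_group_orthogonal[of w e R] by (simp add: orthogonal_transformation_def)

text \<open>If \<alpha> is the image of a simple root under \<open>w\<close>, its reflection is the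
  simple reflection conjugated by \<open>w\<close>.\<close>

lemma reflection_in_weyl_group:
  assumes "\<alpha> \<in> roots e R"
  shows "root_reflection \<alpha> \<in> weyl_group e R"
proof -
  obtain w i where w: "w \<in> weyl_group e R" "i \<in> {1..root_rank R}" "\<alpha> = w (simple_root e R i)"
    using assms by (auto simp: roots_def)
  have "root_reflection \<alpha> x = (w \<circ> root_reflection (simple_root e R i) \<circ> inv_into UNIV w) x" for x
    using root_reflection_conjugate[OF weyl_group_orthogonal[OF w(1)], of _ "inv_into UNIV w x"]
      weyl_group_bij[OF w(1)] w(3) by (simp add: bij_is_surj surj_f_inv_f)
  then have "root_reflection \<alpha> = w \<circ> root_reflection (simple_root e R i) \<circ> inv_into UNIV w"
    by blast
  then show ?thesis
    using weyl_group_comp weyl_group_inv weyl_group_generator w by metis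
qed

lemma simple_root_in_roots: "i \<in> {1..root_rank R} \<Longrightarrow> simple_root e R i \<in> roots e R"
  unfolding roots_def using weyl_group_id[of e R] by (auto intro!: exI[of _ "\<lambda>x. x"])

lemma weyl_orbit_self: "l \<in> weyl_orbit e R l"
  unfolding weyl_orbit_def by (rule image_eqI[OF _ weyl_group_id]) simp

lemma weyl_orbit_closed: "w \<in> weyl_group e R \<Longrightarrow> \<mu> \<in> weyl_orbit e R l \<Longrightarrow> w \<mu> \<in> weyl_orbit e R l"
  unfolding weyl_orbit_def
proof clarify
  fix v assume "w \<in> weyl_group e R" "v \<in> weyl_group e R"
  then show "w (v l) \<in> (\<lambda>w. w l) ` weyl_group e R"
    by (intro image_eqI[where x = "w \<circ> v"] weyl_group_comp) auto
qed

lemma weyl_orbit_inner: "\<mu> \<in> weyl_orbit e R l \<Longrightarrow> \<mu> \<bullet> \<mu> = l \<bullet> l"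
  unfolding weyl_orbit_def using weyl_group_inner by blast

section \<open>Integrality\<close>

text \<open>The coordinate lattice contains the simple roots and the simple coroots of all four
  types, so it can stand in for both the root and the coroot lattice.\<close>

definition integer_vectors :: "'a::euclidean_space set" where
  "integer_vectors = {v. \<forall>b\<in>Basis. v \<bullet> b \<in> \<int>}"

lemma integer_vectors_add: "u \<in> integer_vectors \<Longrightarrow> v \<in> integer_vectors \<Longrightarrow> u + v \<in> integer_vectors"
  by (simp add: integer_vectors_def inner_add_left)

lemma integer_vectors_diff: "u \<in> integer_vectors \<Longrightarrow> v \<in> integer_vectors \<Longrightarrow> u - v \<in> integer_vectors"
  by (simp add: integer_vectors_def inner_diff_left)

lemma integer_vectors_scaleR: "c \<in> \<int> \<Longrightarrow> v \<in> integer_vectors \<Longrightarrow> c *\<^sub>R v \<in> integer_vectors"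
  by (simp add: integer_vectors_def)

lemma integer_vectors_Basis: "b \<in> Basis \<Longrightarrow> b \<in> integer_vectors"
  by (auto simp: integer_vectors_def inner_Basis)

lemma integer_vectors_inner: "u \<in> integer_vectors \<Longrightarrow> v \<in> integer_vectors \<Longrightarrow> u \<bullet> v \<in> \<int>"
  by (subst euclidean_inner) (auto simp: integer_vectors_def intro!: Ints_sum Ints_mult)

text \<open>Each coordinate is an integer between \<open>- B\<close> and \<open>B\<close>, which
  leaves finitely many coordinate functions.\<close>

lemma finite_integer_vectors_bounded: "finite {v \<in> integer_vectors. norm v \<le> B}"
proof (rule finite_subset)
  let ?Z = "PiE Basis (\<lambda>_::'a. {k \<in> \<int>. - B \<le> k \<and> k \<le> B})"
  show "finite ((\<lambda>f. \<Sum>b\<in>Basis. f b *\<^sub>R b) ` ?Z)"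
    by (intro finite_imageI finite_PiE) (auto simp: finite_int_segment)
  show "{v \<in> integer_vectors. norm v \<le> B} \<subseteq> (\<lambda>f. \<Sum>b\<in>Basis. f b *\<^sub>R b) ` ?Z"
  proof
    fix v :: 'a assume v: "v \<in> {v \<in> integer_vectors. norm v \<le> B}"
    let ?f = "restrict (\<lambda>b. v \<bullet> b) Basis"
    have "v = (\<Sum>b\<in>Basis. ?f b *\<^sub>R b)"
      by (simp add: euclidean_representation)
    moreover have "?f \<in> ?Z"
    proof (rule restrict_PiE_iff[THEN iffD2], rule ballI)
      fix b :: 'a assume b: "b \<in> Basis"
      then have "\<bar>v \<bullet> b\<bar> \<le> B"
        using v Basis_le_norm[OF b, of v] by auto
      then show "v \<bullet> b \<in> {k \<in> \<int>. - B \<le> k \<and> k \<le> B}"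
        using v b by (auto simp: integer_vectors_def)
    qed
    ultimately show "v \<in> (\<lambda>f. \<Sum>b\<in>Basis. f b *\<^sub>R b) ` ?Z"
      by blast
  qed
qed

text \<open>Reflections destroy dominance but keep integrality, so arguments about whole orbits are
  carried out in this larger set.\<close>

definition integral_weights :: "(nat \<Rightarrow> 'a::euclidean_space) \<Rightarrow> classical_type \<Rightarrow> 'a set" where
  "integral_weights e R = {l. \<forall>j\<in>{1..root_rank R}. l \<bullet> coroot (simple_root e R j) \<in> \<int>}"

section \<open>Roots, coroots and weights in orthogonal coordinates\<close>

locale classical_root_system =
  fixes R :: classical_type and e :: "nat \<Rightarrow> 'a::euclidean_space"
  assumes valid: "valid_type R"
    and e: "bij_betw e {1..coord_dim R} (Basis :: 'a set)"
begin

lemma e_Basis: "i \<in> {1..coord_dim R} \<Longrightarrow> e i \<in> Basis"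
  using e by (auto simp: bij_betw_def)

lemma e_inner: "i \<in> {1..coord_dim R} \<Longrightarrow> j \<in> {1..coord_dim R} \<Longrightarrow> e i \<bullet> e j = (if i = j then 1 else 0)"
  using e e_Basis by (auto simp: bij_betw_def inner_Basis inj_on_eq_iff)

lemma e_integral: "i \<in> {1..coord_dim R} \<Longrightarrow> e i \<in> integer_vectors"
  by (intro integer_vectors_Basis e_Basis)

text \<open>Later proofs split over the four shapes of a simple root instead of the four types. The
  clause \<open>i - 1 \<noteq> i\<close> records that the two basis vectors differ despite truncated
  subtraction.\<close>

lemma simple_root_cases:
  assumes i: "i \<in> {1..root_rank R}"
  obtains (diff) "i + 1 \<in> {1..coord_dim R}" "i \<in> {1..coord_dim R}" "simple_root e R i = e i - e (i + 1)"
  | (short) "i \<in> {1..coord_dim R}" "simple_root e R i = e i"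
  | (long) "i \<in> {1..coord_dim R}" "simple_root e R i = 2 *\<^sub>R e i"
  | (add) "i \<in> {1..coord_dim R}" "i - 1 \<in> {1..coord_dim R}" "i - 1 \<noteq> i"
      "simple_root e R i = e (i - 1) + e i"
  using i valid by (cases R; cases "i = root_rank R") auto

text \<open>The squared lengths in the four cases are 2, 1, 4 and 2, so the coroots are the root
  itself, \<open>2 *\<^sub>R e i\<close>, \<open>e i\<close> and again the root itself.\<close>

lemma simple_root_integral:
  assumes i: "i \<in> {1..root_rank R}"
  shows "simple_root e R i \<in> integer_vectors" "coroot (simple_root e R i) \<in> integer_vectors"
    "simple_root e R i \<noteq> 0"
proof -
  have "simple_root e R i \<in> integer_vectors \<and> coroot (simple_root e R i) \<in> integer_vectors
    \<and> simple_root e R i \<noteq> 0"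
    using i
  proof (cases rule: simple_root_cases)
    case diff
    then have "(e i - e (i + 1)) \<bullet> (e i - e (i + 1)) = 2"
      by (simp add: inner_diff_left inner_diff_right e_inner)
    then show ?thesis
      using diff(3) e_integral[OF diff(1)] e_integral[OF diff(2)]
      by (auto simp: coroot_def intro: integer_vectors_diff)
  next
    case short
    then show ?thesis
      using e_integral[OF short(1)] e_inner[OF short(1) short(1)]
      by (auto simp: coroot_def intro: integer_vectors_scaleR)
  next
    case long
    then show ?thesis
      using e_integral[OF long(1)] e_inner[OF long(1) long(1)]
      by (auto simp: coroot_def intro: integer_vectors_scaleR)
  next
    case add
    then have "(e (i - 1) + e i) \<bullet> (e (i - 1) + e i) = 2"
      by (simp add: inner_add_left inner_add_right e_inner)
    then show ?thesis
      using add(4) e_integral[OF add(1)] e_integral[OF add(2)]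
      by (auto simp: coroot_def intro: integer_vectors_add)
  qed
  then show "simple_root e R i \<in> integer_vectors" "coroot (simple_root e R i) \<in> integer_vectors"
    "simple_root e R i \<noteq> 0" by auto
qed

text \<open>A simple reflection moves \<open>l\<close> by an integer multiple of a simple root, and
  simple roots pair integrally with simple coroots because both are integer vectors. The quantifier
  over \<open>l\<close> stays inside the induction since a product applies the hypothesis for
  \<open>v\<close> at \<open>w l\<close>.\<close>

lemma weyl_group_integral_weights:
  assumes "w \<in> weyl_group e R"
  shows "\<forall>l \<in> integral_weights e R. w l \<in> integral_weights e R \<and> w l - l \<in> integer_vectors"
  using assms
proof (induction rule: weyl_group_induct)
  case id
  then show ?case by (simp add: integer_vectors_def)
next
  case (reflection i)
  show ?case
  proof
    fix l assume l: "l \<in> integral_weights e R"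
    let ?\<alpha> = "simple_root e R i"
    have k: "l \<bullet> coroot ?\<alpha> \<in> \<int>"
      using l reflection by (auto simp: integral_weights_def)
    have "root_reflection ?\<alpha> l \<bullet> coroot (simple_root e R j) \<in> \<int>"
      if j: "j \<in> {1..root_rank R}" for j
      using l j k integer_vectors_inner[OF simple_root_integral(1)[OF reflection] simple_root_integral(2)[OF j]]
      by (auto simp: inner_root_reflection integral_weights_def intro!: Ints_diff Ints_mult)
    moreover have "(- (l \<bullet> coroot ?\<alpha>)) *\<^sub>R ?\<alpha> \<in> integer_vectors"
      using k simple_root_integral(1)[OF reflection] by (intro integer_vectors_scaleR Ints_minus)
    ultimately show "root_reflection ?\<alpha> l \<in> integral_weights e R \<and> root_reflection ?\<alpha> l - l \<in> integer_vectors"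
      by (simp add: integral_weights_def root_reflection_def)
  qed
next
  case (comp v w)
  show ?case
  proof
    fix l assume "l \<in> integral_weights e R"
    then have "w l \<in> integral_weights e R" "w l - l \<in> integer_vectors"
      "v (w l) \<in> integral_weights e R" "v (w l) - w l \<in> integer_vectors"
      using comp by auto
    then show "(v \<circ> w) l \<in> integral_weights e R \<and> (v \<circ> w) l - l \<in> integer_vectors"
      using integer_vectors_add[of "v (w l) - w l" "w l - l"] by simp
  qed
qed

text \<open>A Weyl orbit of weights lies on a sphere and in a single coset of the lattice of integer vectors.\<close>

lemma finite_weyl_orbit:
  assumes l: "l \<in> integral_weights e R"
  shows "finite (weyl_orbit e R l)"
proof -
  \<comment> \<open>A weight may have fractional coordinates, so only the differences \<mu> -
    \<open>l\<close> are placed in the lattice.\<close>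
  have "(\<lambda>\<mu>. \<mu> - l) ` weyl_orbit e R l \<subseteq> {v \<in> integer_vectors. norm v \<le> 2 * norm l}"
  proof clarify
    fix \<mu> assume \<mu>: "\<mu> \<in> weyl_orbit e R l"
    then have "\<mu> - l \<in> integer_vectors"
      using l weyl_group_integral_weights by (auto simp: weyl_orbit_def)
    moreover have "norm \<mu> = norm l"
      using weyl_orbit_inner[OF \<mu>] by (simp add: norm_eq_sqrt_inner)
    ultimately show "\<mu> - l \<in> integer_vectors \<and> norm (\<mu> - l) \<le> 2 * norm l"
      using norm_triangle_ineq4[of \<mu> l] by simp
  qed
  then have "finite ((\<lambda>\<mu>. \<mu> - l) ` weyl_orbit e R l)"
    using finite_integer_vectors_bounded finite_subset by blast
  then show ?thesis
    by (rule finite_imageD) (simp add: inj_on_def)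
qed

lemma root_nonzero:
  assumes "\<alpha> \<in> roots e R"
  shows "\<alpha> \<noteq> 0"
proof -
  obtain w i where w: "w \<in> weyl_group e R" "i \<in> {1..root_rank R}" "\<alpha> = w (simple_root e R i)"
    using assms by (auto simp: roots_def)
  then have "\<alpha> \<bullet> \<alpha> = simple_root e R i \<bullet> simple_root e R i"
    using weyl_group_inner by blast
  then show ?thesis
    using simple_root_integral(3)[OF w(2)] by auto
qed

text \<open>Moving \<open>w\<close> to the other side turns the pairing with the coroot of a general
  root into that of another integral weight with a simple coroot.\<close>

lemma weight_inner_coroot_integral:
  assumes l: "l \<in> integral_weights e R" and "\<alpha> \<in> roots e R"
  shows "l \<bullet> coroot \<alpha> \<in> \<int>"
proof -
  obtain w i where w: "w \<in> weyl_group e R" "i \<in> {1..root_rank R}" "\<alpha> = w (simple_root e R i)"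
    using assms by (auto simp: roots_def)
  have "w (inv_into UNIV w l) = l"
    using weyl_group_bij[OF w(1)] by (simp add: bij_is_surj surj_f_inv_f)
  then have "l \<bullet> coroot \<alpha> = inv_into UNIV w l \<bullet> coroot (simple_root e R i)"
    using weyl_group_inner[OF w(1), of "inv_into UNIV w l" "simple_root e R i"]
      weyl_group_inner[OF w(1), of "simple_root e R i" "simple_root e R i"]
    by (simp add: inner_coroot w(3))
  also have "\<dots> \<in> \<int>"
    using weyl_group_integral_weights[OF weyl_group_inv[OF w(1)]] l w(2)
    by (auto simp: integral_weights_def)
  finally show ?thesis .
qed

text \<open>The reflection in \<open>\<alpha>\<close> permutes the orbit, preserves the values of the exponentials at \<open>x\<close>
  and negates the factors \<open>\<mu> \<bullet> \<alpha>\<close>.\<close>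

lemma normal_derivative_sum_zero:
  assumes l: "l \<in> integral_weights e R" and \<alpha>: "\<alpha> \<in> roots e R" and x: "\<alpha> \<bullet> x \<in> \<int>"
  shows "(\<Sum>\<mu>\<in>weyl_orbit e R l. complex_of_real (\<mu> \<bullet> \<alpha>) * plane_wave \<mu> x) = 0"
proof -
  let ?s = "root_reflection \<alpha>" and ?O = "weyl_orbit e R l"
  let ?S = "\<Sum>\<mu>\<in>?O. complex_of_real (\<mu> \<bullet> \<alpha>) * plane_wave \<mu> x"
  have s: "?s \<in> weyl_group e R"
    using \<alpha> by (rule reflection_in_weyl_group)
  have bij: "bij_betw ?s ?O ?O"
    by (rule bij_betw_byWitness[where f' = ?s]) (use weyl_orbit_closed[OF s] in auto)
  have wave: "plane_wave (?s \<mu>) x = plane_wave \<mu> x" if "\<mu> \<in> ?O" for \<mu>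
  proof -
    have "\<mu> \<in> integral_weights e R"
      using that l weyl_group_integral_weights by (auto simp: weyl_orbit_def)
    then have "(\<mu> \<bullet> coroot \<alpha>) * (\<alpha> \<bullet> x) \<in> \<int>"
      using weight_inner_coroot_integral \<alpha> x by (intro Ints_mult) auto
    then obtain k :: int where k: "(\<mu> \<bullet> coroot \<alpha>) * (\<alpha> \<bullet> x) = of_int k"
      by (auto elim: Ints_cases)
    show ?thesis
      \<comment> \<open>The reflection lowers the inner product with \<open>x\<close> by the integer
        \<open>k\<close>, so the exponents differ by -2 pi i \<open>k\<close>, a period of
        \<open>exp\<close>.\<close>
      unfolding inner_root_reflection k
      by (subst exp_eq) (rule exI[of _ "- k"], simp add: algebra_simps)
  qed
  have "?S = (\<Sum>\<mu>\<in>?O. complex_of_real (?s \<mu> \<bullet> \<alpha>) * plane_wave (?s \<mu>) x)"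
    by (rule sum.reindex_bij_betw[OF bij, symmetric])
  also have "\<dots> = (\<Sum>\<mu>\<in>?O. - (complex_of_real (\<mu> \<bullet> \<alpha>) * plane_wave \<mu> x))"
    by (rule sum.cong[OF refl]) (simp only: inner_root_reflection_root wave, simp)
  also have "\<dots> = - ?S"
    by (rule sum_negf)
  finally show ?thesis
    by simp
qed

section \<open>Nonvanishing on the fundamental domain\<close>

lemma ex_strictly_dominant:
  "\<exists>y \<in> span (roots e R). \<forall>i\<in>{1..root_rank R}. y \<bullet> simple_root e R i > 0"
proof -
  let ?n = "coord_dim R"
  \<comment> \<open>The coordinates of \<open>y0\<close> are \<open>?n\<close>, \<open>?n\<close> -
    1, ..., 1. They are positive and strictly decreasing, so every shape of simple root pairs
    positively with \<open>y0\<close>.\<close>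
  define y0 where "y0 = (\<Sum>k=1..?n. (real ?n + 1 - real k) *\<^sub>R e k)"
  have y0: "y0 \<bullet> e i = real ?n + 1 - real i" if "i \<in> {1..?n}" for i
  proof -
    have "y0 \<bullet> e i = (\<Sum>k=1..?n. if k = i then real ?n + 1 - real k else 0)"
      unfolding y0_def inner_sum_left using that by (intro sum.cong) (auto simp: e_inner)
    also have "\<dots> = real ?n + 1 - real i"
      using that by simp
    finally show ?thesis .
  qed
  have pos: "y0 \<bullet> simple_root e R i > 0" if "i \<in> {1..root_rank R}" for i
    using that
    by (cases rule: simple_root_cases) (auto simp: inner_diff_right inner_add_right y0)
  \<comment> \<open>In type A the vector \<open>y0\<close> lies outside the span of the roots.
    Orthogonal projection onto the span leaves its pairings with the roots unchanged.\<close>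
  obtain y z where yz: "y \<in> span (roots e R)" "\<And>w. w \<in> span (roots e R) \<Longrightarrow> orthogonal z w" "y0 = y + z"
    using orthogonal_subspace_decomp_exists[of "roots e R" y0] by metis
  have "y \<bullet> simple_root e R i > 0" if i: "i \<in> {1..root_rank R}" for i
    using pos[OF i] yz(2)[OF span_base[OF simple_root_in_roots[OF i]]] yz(3)
    by (simp add: inner_add_left orthogonal_def)
  then show ?thesis
    using yz(1) by blast
qed

text \<open>The orbit function is positive at the origin, and the open simplex accumulates there.\<close>

lemma ex_orbit_function_nonzero:
  assumes l: "l \<in> integral_weights e R"
  shows "\<exists>x \<in> fund_domain e R \<xi>. orbit_function e R l x \<noteq> 0"
proof -
  obtain y where y: "y \<in> span (roots e R)" "\<And>i. i \<in> {1..root_rank R} \<Longrightarrow> y \<bullet> simple_root e R i > 0"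
    using ex_strictly_dominant by blast
  let ?f = "\<lambda>t::real. orbit_function e R l (t *\<^sub>R y)"
  have "?f 0 = of_nat (card (weyl_orbit e R l))"
    by (simp add: orbit_function_def)
  \<comment> \<open>Since \<open>card\<close> of an infinite set is 0, finiteness of the orbit
    enters here along with its nonemptiness.\<close>
  then have "?f 0 \<noteq> 0"
    using finite_weyl_orbit[OF l] weyl_orbit_self[of l e R] by (auto simp: card_eq_0_iff)
  moreover have "isCont ?f 0"
    unfolding orbit_function_def by (intro continuous_intros)
  ultimately have ev1: "\<forall>\<^sub>F t in at_right 0. ?f t \<noteq> 0"
    using tendsto_imp_eventually_ne[of ?f "?f 0" "at_right 0"]
    by (meson continuous_within filterlim_at_split)
  \<comment> \<open>Near 0 the bound by 1 holds whatever the sign of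
    \<open>y \<bullet> \<xi>\<close>.\<close>
  have "((\<lambda>t. t * (y \<bullet> \<xi>)) \<longlongrightarrow> 0 * (y \<bullet> \<xi>)) (at_right 0)"
    by (intro tendsto_intros)
  then have ev2: "\<forall>\<^sub>F t in at_right 0. t * (y \<bullet> \<xi>) < 1"
    by (intro order_tendstoD(2)) auto
  have ev3: "\<forall>\<^sub>F t::real in at_right 0. t > 0"
    by (rule eventually_at_right_less)
  have "\<forall>\<^sub>F t in at_right 0. ?f t \<noteq> 0 \<and> t * (y \<bullet> \<xi>) < 1 \<and> t > 0"
    using ev1 ev2 ev3 by eventually_elim auto
  then obtain t where t: "?f t \<noteq> 0" "t * (y \<bullet> \<xi>) < 1" "t > 0"
    using eventually_happens'[OF trivial_limit_at_right_real] by blast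
  then have "t *\<^sub>R y \<in> fund_domain e R \<xi>"
    using y by (auto simp: fund_domain_def span_scale)
  then show ?thesis
    using t(1) by blast
qed

section \<open>The Neumann boundary condition\<close>

text \<open>The facet witnessing that \<open>m\<close> is normal lies in the wall of a root, and
  \<open>m\<close> must be a multiple of that root. Where several facets meet at \<open>x\<close>,
  each normal is treated with its own facet, so corners are covered too.\<close>

lemma orbit_function_normal_derivative:
  assumes l: "l \<in> integral_weights e R" and \<xi>: "\<xi> \<in> roots e R"
    and m: "boundary_normal (span (roots e R)) (fund_domain e R \<xi>) x m"
  shows "((\<lambda>t. orbit_function e R l (x + t *\<^sub>R m)) has_vector_derivative 0) (at 0)"
proof -
  let ?V = "span (roots e R)" and ?F = "fund_domain e R \<xi>"
  \<comment> \<open>All walls are written in the form \<open>a \<bullet> y < b\<close>, which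
    requires the simple roots with a minus sign and bound 0.\<close>
  let ?C = "(\<lambda>i. (- simple_root e R i, 0::real)) ` {1..root_rank R} \<union> {(\<xi>, 1)}"
  obtain T where mV: "m \<in> ?V" and T: "T facet_of closure ?F" and xT: "x \<in> T"
    and orth: "\<And>y z. y \<in> T \<Longrightarrow> z \<in> T \<Longrightarrow> m \<bullet> (y - z) = 0"
    using m unfolding boundary_normal_def by blast
  have F: "?F = ?V \<inter> {y. \<forall>(a, b)\<in>?C. a \<bullet> y < b}"
    by (auto simp: fund_domain_def inner_commute)
  have ne: "?F \<noteq> {}"
    using ex_orbit_function_nonzero[OF l] by blast
  have fin: "finite ?C"
    by simp
  note facet = facet_in_tight_hyperplane[OF subspace_span fin F ne T]
  obtain a b where ab: "(a, b) \<in> ?C" "\<And>y. y \<in> T \<Longrightarrow> a \<bullet> y = b"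
    using facet(3) by blast
  \<comment> \<open>On the wall of \<xi> the value of \<alpha> at \<open>x\<close> is 1, on a simple
    wall it is 0; both are integers, as the reflection argument requires.\<close>
  obtain \<alpha> where \<alpha>: "\<alpha> \<in> roots e R" "\<alpha> \<bullet> x \<in> \<int>" "\<And>y z. y \<in> T \<Longrightarrow> z \<in> T \<Longrightarrow> \<alpha> \<bullet> (y - z) = 0"
  proof (cases "(a, b) = (\<xi>, 1)")
    case True
    then show thesis
      using ab(2) xT by (intro that[of \<xi>] \<xi>) (simp_all add: inner_diff_right)
  next
    case False
    then obtain i where i: "i \<in> {1..root_rank R}" "a = - simple_root e R i" "b = 0"
      using ab(1) by blast
    have "simple_root e R i \<bullet> y = 0" if "y \<in> T" for y
      using ab(2)[OF that] i by simp
    then show thesis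
      using xT by (intro that[of "simple_root e R i"] simple_root_in_roots i(1)) (simp_all add: inner_diff_right)
  qed
  have "\<exists>k. m = k *\<^sub>R \<alpha>"
    by (rule hyperplane_normals_parallel[OF subspace_span facet(1) xT facet(2) span_base[OF \<alpha>(1)]
        root_nonzero[OF \<alpha>(1)] \<alpha>(3) mV orth])
  then obtain k where k: "m = k *\<^sub>R \<alpha>"
    by blast
  have "((\<lambda>t. orbit_function e R l (x + t *\<^sub>R m)) has_vector_derivative
      (\<Sum>\<mu>\<in>weyl_orbit e R l. 1 * (2 * complex_of_real pi * \<i> * complex_of_real (\<mu> \<bullet> m)) * plane_wave \<mu> x)) (at 0)"
    using exp_sum_has_vector_derivative[where c = "\<lambda>_. 1"] by (simp add: orbit_function_def)
  \<comment> \<open>With \<open>m = k *\<^sub>R \<alpha>\<close> the derivative is a multiple of the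
    sum that the reflection in \<alpha> negates.\<close>
  also have "(\<Sum>\<mu>\<in>weyl_orbit e R l. 1 * (2 * complex_of_real pi * \<i> * complex_of_real (\<mu> \<bullet> m)) * plane_wave \<mu> x)
      = 2 * complex_of_real pi * \<i> * complex_of_real k *
        (\<Sum>\<mu>\<in>weyl_orbit e R l. complex_of_real (\<mu> \<bullet> \<alpha>) * plane_wave \<mu> x)"
    unfolding k sum_distrib_left by (intro sum.cong) auto
  also have "\<dots> = 0"
    using normal_derivative_sum_zero[OF l \<alpha>(1,2)] by simp
  finally show ?thesis .
qed

end

theorem mainTheorem2:
  fixes R :: classical_type
    and e :: "nat \<Rightarrow> 'a::euclidean_space"
    and \<xi> l :: 'a
  assumes "valid_type R"
    and "bij_betw e {1..coord_dim R} (Basis :: 'a set)"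
    and "is_highest_root e R \<xi>"
    and "l \<in> dominant_weights e R"
  shows "(\<forall>x. laplacian e (coord_dim R) (orbit_function e R l) x =
              complex_of_real (- 4 * pi\<^sup>2 * (l \<bullet> l)) * orbit_function e R l x)
       \<and> l \<bullet> l = (\<Sum>i=1..coord_dim R. (l \<bullet> e i)\<^sup>2)
       \<and> eigenfunction_on (laplacian e (coord_dim R)) (fund_domain e R \<xi>)
            (orbit_function e R l) (complex_of_real (- 4 * pi\<^sup>2 * (l \<bullet> l)))
       \<and> (\<forall>x \<in> rel_frontier (fund_domain e R \<xi>).
            \<forall>m. boundary_normal (span (roots e R)) (fund_domain e R \<xi>) x m \<longrightarrow>
              ((\<lambda>t. orbit_function e R l (x + t *\<^sub>R m)) has_vector_derivative 0) (at 0))"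
proof -
  interpret classical_root_system R e
    using assms by unfold_locales
  have \<xi>: "\<xi> \<in> roots e R"
    using assms(3) by (simp add: is_highest_root_def)
  \<comment> \<open>Natural numbers are integers, so a dominant weight is in particular an integral
    one.\<close>
  have l: "l \<in> integral_weights e R"
    using assms(4) Nats_subset_Ints by (auto simp: dominant_weights_def integral_weights_def)
  have lap: "laplacian e (coord_dim R) (orbit_function e R l) x =
      complex_of_real (- 4 * pi\<^sup>2 * (l \<bullet> l)) * orbit_function e R l x" for x
    unfolding orbit_function_def
    by (rule laplacian_plane_wave_sum[OF assms(2)]) (rule weyl_orbit_inner)
  show ?thesis
    unfolding eigenfunction_on_def
    using lap inner_self_eq_sum_coordinates[OF assms(2)] ex_orbit_function_nonzero[OF l, of \<xi>]
      orbit_function_normal_derivative[OF l \<xi>]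
    by blast
qed

end
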